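(* Let $X$ be a (nonempty) Tychonoff space and let $L$ be a truncated vector sublattice of $C(X)$. A nonzero linear functional $\psi$ on $L$ is a truncation homomorphism if and only if there exists $u\in\beta X$ such that $\psi(f)=f^{\beta}(u)$ for all $f\in L$.
   Context: $C(X)$ is the set of all real-valued continuous functions on $X$, with pointwise operations and order, so $(f\wedge g)(x)=\min\{f(x),g(x)\}$. $\mathbf{1}_{X}$ is the constant function $1$ on $X$. A truncated vector sublattice of $C(X)$ is a linear subspace $L$ of $C(X)$ closed under pointwise minimum and maximum and such that $f\wedge\mathbf{1}_{X}\in L$ for all $f\in L$ (it is not assumed that $\mathbf{1}_{X}\in L$). A truncation homomorphism on $L$ is a nonzero linear functional $\psi:L\to\mathbb{R}$ such that $\psi(f\wedge\mathbf{1}_{X})=\min\{\psi(f),1\}$ for all $f\in L$. $\beta X$ is the Stone-Čech compactification of $X$, and for $f\in C(X)$, $f^{\beta}:\beta X\to\mathbb{R}\cup\{\infty\}$ denotes the unique continuous extension of $f$ to $\beta X$ with values in the one-point compactification $\mathbb{R}\cup\{\infty\}$ of $\mathbb{R}$. The condition $\psi(f)=f^{\beta}(u)$ includes that $f^{\beta}(u)\in\mathbb{R}$. *)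

theory Defs
  imports "HOL-Analysis.Analysis"
begin

definition tychonoff_space :: "'a topology \<Rightarrow> bool" where
  "tychonoff_space X \<longleftrightarrow> completely_regular_space X \<and> Hausdorff_space X"

definition real_cont :: "('a::topological_space \<Rightarrow> real) set" where
  "real_cont = {f. continuous_on UNIV f}"

definition truncated_vector_sublattice :: "('a::topological_space \<Rightarrow> real) set \<Rightarrow> bool" where
  "truncated_vector_sublattice L \<longleftrightarrow>
     L \<subseteq> real_cont \<and>
     (\<lambda>x. 0) \<in> L \<and>
     (\<forall>f\<in>L. \<forall>g\<in>L. (\<lambda>x. f x + g x) \<in> L) \<and>
     (\<forall>c. \<forall>f\<in>L. (\<lambda>x. c * f x) \<in> L) \<and>
     (\<forall>f\<in>L. \<forall>g\<in>L. (\<lambda>x. min (f x) (g x)) \<in> L) \<and>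
     (\<forall>f\<in>L. \<forall>g\<in>L. (\<lambda>x. max (f x) (g x)) \<in> L) \<and>
     (\<forall>f\<in>L. (\<lambda>x. min (f x) 1) \<in> L)"

(* Functionals on L are total functions on all of 'a => real; only their values on L matter. *)
definition nonzero_linear_functional ::
    "('a \<Rightarrow> real) set \<Rightarrow> (('a \<Rightarrow> real) \<Rightarrow> real) \<Rightarrow> bool" where
  "nonzero_linear_functional L \<psi> \<longleftrightarrow>
     (\<forall>f\<in>L. \<forall>g\<in>L. \<psi> (\<lambda>x. f x + g x) = \<psi> f + \<psi> g) \<and>
     (\<forall>c. \<forall>f\<in>L. \<psi> (\<lambda>x. c * f x) = c * \<psi> f) \<and>
     (\<exists>f\<in>L. \<psi> f \<noteq> 0)"

definition truncation_homomorphism ::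
    "('a \<Rightarrow> real) set \<Rightarrow> (('a \<Rightarrow> real) \<Rightarrow> real) \<Rightarrow> bool" where
  "truncation_homomorphism L \<psi> \<longleftrightarrow>
     nonzero_linear_functional L \<psi> \<and>
     (\<forall>f\<in>L. \<psi> (\<lambda>x. min (f x) 1) = min (\<psi> f) 1)"

(* The Stone-Cech compactification: the closure of the image of X under the evaluation map
   into the cube [0,1]^C(X,[0,1]). *)
definition unit_cont :: "('a::topological_space \<Rightarrow> real) set" where
  "unit_cont = {g. continuous_on UNIV g \<and> range g \<subseteq> {0..1}}"

definition stone_cech_cube :: "(('a::topological_space \<Rightarrow> real) \<Rightarrow> real) topology" where
  "stone_cech_cube = product_topology (\<lambda>g. top_of_set {0..1}) unit_cont"

definition stone_cech_embed :: "'a::topological_space \<Rightarrow> (('a \<Rightarrow> real) \<Rightarrow> real)" where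
  "stone_cech_embed x = (\<lambda>g\<in>unit_cont. g x)"

definition stone_cech :: "(('a::topological_space \<Rightarrow> real) \<Rightarrow> real) topology" where
  "stone_cech = subtopology stone_cech_cube (stone_cech_cube closure_of range stone_cech_embed)"

(* The extension f^beta. Points of the one-point compactification of the reals are Some r, for
   real r, and None, the point at infinity. The value is fixed to be undefined off the carrier of
   stone_cech, so that the extension is unique as a HOL function. *)
definition beta_ext ::
    "('a::topological_space \<Rightarrow> real) \<Rightarrow> (('a \<Rightarrow> real) \<Rightarrow> real) \<Rightarrow> real option" where
  "beta_ext f = (THE F. F \<in> extensional (topspace stone_cech) \<and>
     continuous_map stone_cech (Alexandroff_compactification euclideanreal) F \<and>
     (\<forall>x. F (stone_cech_embed x) = Some (f x)))"

end

theory Submission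
  imports Defs
begin

text \<open>
  A truncation homomorphism \<open>\<psi>\<close> satisfies \<open>\<psi> f \<le> c\<close> whenever \<open>f \<le> c\<close> with \<open>c > 0\<close>; letting \<open>c\<close> tend to
  \<open>0\<close> in \<open>\<psi> (f \<and> c) = \<psi> f \<and> c\<close> shows that it preserves absolute values. Pick \<open>e \<le> 1\<close> in \<open>L\<close> with
  \<open>\<psi> e = 1\<close>. For finitely many \<open>f \<in> L\<close>, the function \<open>e - \<Sum> \<bar>f - \<psi> f \<cdot> e\<bar>\<close> is at most \<open>1\<close> and has
  \<open>\<psi>\<close>-value \<open>1\<close>, so it comes arbitrarily close to \<open>1\<close>; at such a point every \<open>f\<close> is close to \<open>\<psi> f\<close>.
  Compactness of \<open>\<beta>X\<close> then gives a single \<open>u\<close> at which all extensions have the prescribed value.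
  The converse holds because finitely many of the relations \<open>f\<^sup>\<beta> u = \<psi> f\<close> are approximated at
  points of \<open>X\<close>.
\<close>

section \<open>The extension to the Stone-Cech compactification\<close>

text \<open>The point \<open>t\<close> of the projective line corresponds to the point \<open>(1/(1+t\<^sup>2), t/(1+t\<^sup>2))\<close> of the
  circle \<open>b\<^sup>2 = a - a\<^sup>2\<close>, and the point at infinity to \<open>(0, 0)\<close>.\<close>

lemma continuous_map_Alexandroff_circle:
  fixes a b :: "'z \<Rightarrow> real"
  assumes a: "continuous_map Z euclideanreal a"
    and b: "continuous_map Z euclideanreal b"
    and circle: "\<And>z. z \<in> topspace Z \<Longrightarrow> (b z)\<^sup>2 = a z - (a z)\<^sup>2"
  shows "continuous_map Z (Alexandroff_compactification euclideanreal)
           (\<lambda>z. if a z = 0 then None else Some (b z / a z))"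
    (is "continuous_map _ _ ?F")
proof -
  \<comment> \<open>Clamping the denominator at \<open>m\<close> keeps the quotient continuous where
    \<open>a\<close> vanishes; on the region \<open>a z >= m\<close> it equals
    \<open>b z / a z\<close>.\<close>
  define q where "q m z = b z / max (a z) m" for m z
  have q: "continuous_map Z euclideanreal (q m)" if "m > 0" for m
    unfolding q_def using that
    by (intro continuous_map_real_divide continuous_map_real_max a b)
       (auto simp: max_def)
  have a0: "a z \<ge> 0" if "z \<in> topspace Z" for z
  proof -
    have "a z = (a z)\<^sup>2 + (b z)\<^sup>2" using circle [OF that] by simp
    then show ?thesis by (metis add_nonneg_nonneg zero_le_power2)
  qed
  \<comment> \<open>With \<open>t = b z / a z\<close> this reads \<open>a z = 1 / (1 + t^2)\<close>,
    so a bound on \<open>t\<close> keeps \<open>a z\<close> away from 0.\<close>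
  have ratio: "a z * (1 + (b z / a z)\<^sup>2) = 1" if "z \<in> topspace Z" "a z \<noteq> 0" for z
    using circle [OF that(1)] that(2) by (simp add: power_divide field_simps power2_eq_square)
  have op: "openin Z {z \<in> topspace Z. ?F z \<in> Some ` U}" if U: "open U" for U
  proof -
    have "{z \<in> topspace Z. ?F z \<in> Some ` U} =
        (\<Union>m\<in>{0<..}. {z \<in> topspace Z. a z \<in> {m<..}} \<inter> {z \<in> topspace Z. q m z \<in> U})"
      (is "?A = ?B")
    proof
      show "?A \<subseteq> ?B"
      proof
        fix z assume z: "z \<in> ?A"
        then have "z \<in> topspace Z" "a z > 0" "b z / a z \<in> U"
          using a0 [of z] by (auto split: if_splits)
        then show "z \<in> ?B"
          by (intro UN_I [of "a z / 2"]) (auto simp: q_def max_def)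
      qed
      show "?B \<subseteq> ?A"
        by (auto simp: q_def max_def)
    qed
    moreover have "openin Z ?B"
    proof (intro openin_Union ballI)
      fix T assume "T \<in> (\<lambda>m. {z \<in> topspace Z. a z \<in> {m<..}} \<inter> {z \<in> topspace Z. q m z \<in> U}) ` {0<..}"
      then obtain m where m: "m > 0"
        and T: "T = {z \<in> topspace Z. a z \<in> {m<..}} \<inter> {z \<in> topspace Z. q m z \<in> U}"
        by blast
      show "openin Z T"
        unfolding T using U
        by (intro openin_Int openin_continuous_map_preimage [OF a]
              openin_continuous_map_preimage [OF q [OF m]]) auto
    qed
    ultimately show ?thesis by simp
  qed
  have cl: "closedin Z {z \<in> topspace Z. ?F z \<in> Some ` C}" if C: "compact C" for C
  proof -
    obtain M where M: "\<And>t. t \<in> C \<Longrightarrow> \<bar>t\<bar> \<le> M"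
      using compact_imp_bounded [OF C] by (auto simp: bounded_iff)
    \<comment> \<open>If \<open>b z / a z\<close> lies in \<open>C\<close>, then
      \<open>ratio\<close> forces \<open>a z >= m\<close>, so the preimage of \<open>Some\<close>
      applied to \<open>C\<close> lies where \<open>?F z\<close> is
      \<open>Some (q m z)\<close>.\<close>
    define m where "m = 1 / (1 + M\<^sup>2)"
    have m: "m > 0" unfolding m_def by (simp add: add_pos_nonneg)
    have "{z \<in> topspace Z. ?F z \<in> Some ` C} =
        {z \<in> topspace Z. a z \<in> {m..}} \<inter> {z \<in> topspace Z. q m z \<in> C}" (is "?A = ?B")
    proof
      show "?A \<subseteq> ?B"
      proof
        fix z assume "z \<in> ?A"
        then have z: "z \<in> topspace Z" "a z > 0" "b z / a z \<in> C"
          using a0 [of z] by (auto split: if_splits)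
        have "(b z / a z)\<^sup>2 \<le> M\<^sup>2"
          using M [OF z(3)] by (metis abs_ge_zero power2_abs power_mono)
        then have "a z * (1 + (b z / a z)\<^sup>2) \<le> a z * (1 + M\<^sup>2)"
          using z(2) by (intro mult_left_mono) auto
        then have "m \<le> a z"
          using ratio [of z] z unfolding m_def
          by (subst pos_divide_le_eq) (auto simp: add_pos_nonneg)
        then show "z \<in> ?B"
          using z by (simp add: q_def max_def)
      qed
      show "?B \<subseteq> ?A"
        using m by (auto simp: q_def max_def split: if_splits)
    qed
    moreover have "closedin Z ?B"
      using compact_imp_closed [OF C]
      by (intro closedin_Int closedin_continuous_map_preimage [OF a]
            closedin_continuous_map_preimage [OF q [OF m]]) auto
    ultimately show ?thesis by simp
  qed
  have "openin Z {z \<in> topspace Z. ?F z \<in> V}"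
    if V: "openin (Alexandroff_compactification euclideanreal) V" for V
  proof -
    consider U where "open U" "V = Some ` U"
      | C where "compact C" "V = insert None (Some ` (UNIV - C))"
      using V by (auto simp: openin_Alexandroff_compactification)
    then show ?thesis
    proof cases
      case 1
      then show ?thesis using op by simp
    next
      case 2
      then have "{z \<in> topspace Z. ?F z \<in> V} = topspace Z - {z \<in> topspace Z. ?F z \<in> Some ` C}"
        by auto
      then show ?thesis using cl [OF 2(1)] by (simp add: openin_diff)
    qed
  qed
  then show ?thesis by (auto simp: continuous_map)
qed

section \<open>Density, compactness and coordinate maps of the Stone-Cech compactification\<close>

lemma stone_cech_embed_in_cube: "stone_cech_embed x \<in> topspace stone_cech_cube"
  by (auto simp: stone_cech_cube_def stone_cech_embed_def unit_cont_def)

lemma topspace_stone_cech: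
  "topspace stone_cech = stone_cech_cube closure_of range stone_cech_embed"
  unfolding stone_cech_def topspace_subtopology
  using closure_of_subset_topspace by fastforce

lemma stone_cech_embed_in: "stone_cech_embed x \<in> topspace stone_cech"
  unfolding topspace_stone_cech
  using closure_of_subset [of "range stone_cech_embed" stone_cech_cube] stone_cech_embed_in_cube
  by blast

text \<open>Density inside the compactification itself allows identities between continuous maps
  into a Hausdorff space to be checked at the points \<open>stone_cech_embed x\<close>.\<close>

lemma stone_cech_dense:
  "stone_cech closure_of range (stone_cech_embed :: 'a::topological_space \<Rightarrow> _) = topspace stone_cech"
proof -
  have "range (stone_cech_embed :: 'a \<Rightarrow> _) \<subseteq> stone_cech_cube closure_of range stone_cech_embed"
    using stone_cech_embed_in unfolding topspace_stone_cech by blast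
  then show ?thesis
    by (simp only: topspace_stone_cech) (simp add: stone_cech_def closure_of_subtopology Int_absorb1)
qed

text \<open>The cube is compact by Tychonoff's theorem, and \<open>stone_cech\<close> is a closed
  subspace of it.\<close>

lemma compact_space_stone_cech: "compact_space (stone_cech :: (('a::topological_space \<Rightarrow> real) \<Rightarrow> real) topology)"
proof -
  have "compact_space (stone_cech_cube :: (('a \<Rightarrow> real) \<Rightarrow> real) topology)"
    unfolding stone_cech_cube_def compact_space_product_topology
    by (simp add: compact_space_subtopology)
  then show ?thesis
    unfolding stone_cech_def
    by (simp add: closedin_compact_space compact_space_subtopology closedin_closure_of)
qed

text \<open>The coordinate projection at \<open>g\<close> is the continuous extension of
  \<open>g\<close>.\<close>

lemma continuous_map_stone_cech_eval:
  assumes "g \<in> unit_cont"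
  shows "continuous_map stone_cech euclideanreal (\<lambda>u. u g)"
  using continuous_map_product_projection [OF assms, of "\<lambda>g. top_of_set {0..1::real}"]
  unfolding stone_cech_def stone_cech_cube_def
  by (intro continuous_map_from_subtopology) (simp add: continuous_map_in_subtopology)

section \<open>Existence, uniqueness and approximation of the extension\<close>

lemma Hausdorff_Alexandroff_real:
  "Hausdorff_space (Alexandroff_compactification euclideanreal)"
  by (simp add: Hausdorff_space_Alexandroff_compactification locally_compact_space_euclidean)

text \<open>Existence: the bounded functions \<open>1 / (1 + f^2)\<close> and
  \<open>f / (1 + f^2)\<close> extend through coordinate projections, the circle equation carries
  over by density, and the quotient of the two extensions is the required map. Uniqueness: the
  embedded points are dense and the target is Hausdorff.\<close>

lemma ex1_beta_ext:
  fixes f :: "'a::topological_space \<Rightarrow> real"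
  assumes f: "f \<in> real_cont"
  shows "\<exists>!F. F \<in> extensional (topspace stone_cech) \<and>
     continuous_map stone_cech (Alexandroff_compactification euclideanreal) F \<and>
     (\<forall>x. F (stone_cech_embed x) = Some (f x))"
proof (rule ex_ex1I)
  define a where "a x = 1 / (1 + (f x)\<^sup>2)" for x
  \<comment> \<open>The shift moves the range of \<open>t / (1 + t^2)\<close>, which lies in
    \<open>[-1/2, 1/2]\<close>, into \<open>[0, 1]\<close>.\<close>
  define b where "b x = 1/2 + f x / (1 + (f x)\<^sup>2)" for x
  have pos: "1 + (f x)\<^sup>2 > 0" for x by (simp add: add_pos_nonneg)
  have cont: "continuous_on UNIV f" using f by (simp add: real_cont_def)
  have aU: "a \<in> unit_cont"
    unfolding unit_cont_def a_def using pos
    by (auto intro!: continuous_intros cont simp: less_imp_neq [symmetric] less_imp_le)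
  have "\<bar>f x / (1 + (f x)\<^sup>2)\<bar> \<le> 1/2" for x
  proof -
    have "0 \<le> (\<bar>f x\<bar> - 1)\<^sup>2" by simp
    then have "2 * \<bar>f x\<bar> \<le> 1 + (f x)\<^sup>2" by (simp add: power2_diff)
    then show ?thesis using pos [of x] by (simp add: abs_divide pos_divide_le_eq)
  qed
  then have b01: "0 \<le> b x \<and> b x \<le> 1" for x
    unfolding b_def abs_le_iff by (smt (verit) field_sum_of_halves)
  moreover have "continuous_on UNIV b"
    unfolding b_def using pos
    by (auto intro!: continuous_intros cont simp: less_imp_neq [symmetric])
  ultimately have bU: "b \<in> unit_cont"
    unfolding unit_cont_def by auto
  note ca = continuous_map_stone_cech_eval [OF aU]
  have cb: "continuous_map stone_cech euclideanreal (\<lambda>u. u b - 1/2)"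
    by (intro continuous_map_diff continuous_map_stone_cech_eval bU) simp
  have ea: "stone_cech_embed x a = a x" and eb: "stone_cech_embed x b = b x" for x
    using aU bU by (auto simp: stone_cech_embed_def)
  have circle: "(u b - 1/2)\<^sup>2 = u a - (u a)\<^sup>2" if "u \<in> topspace stone_cech" for u
  proof (rule forall_in_closure_of_eq
      [where S = "range stone_cech_embed" and X = stone_cech and Y = euclideanreal
        and f = "\<lambda>u. (u b - 1/2)\<^sup>2" and g = "\<lambda>u. u a - (u a)\<^sup>2"])
    show "u \<in> stone_cech closure_of range stone_cech_embed"
      using that by (simp add: stone_cech_dense)
    show "continuous_map stone_cech euclideanreal (\<lambda>u. (u b - 1/2)\<^sup>2)"
      "continuous_map stone_cech euclideanreal (\<lambda>u. u a - (u a)\<^sup>2)"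
      by (intro continuous_map_real_pow continuous_map_diff ca cb)+
    show "(v b - 1/2)\<^sup>2 = v a - (v a)\<^sup>2" if "v \<in> range stone_cech_embed" for v
    proof -
      have "(t / (1 + t\<^sup>2))\<^sup>2 = 1 / (1 + t\<^sup>2) - (1 / (1 + t\<^sup>2))\<^sup>2" for t :: real
      proof -
        have "1 + t\<^sup>2 \<noteq> 0" by (metis add_pos_nonneg less_irrefl zero_le_power2 zero_less_one)
        then have "1 / (1 + t\<^sup>2) - (1 / (1 + t\<^sup>2))\<^sup>2 = ((1 + t\<^sup>2) - 1) / (1 + t\<^sup>2)\<^sup>2"
          unfolding diff_divide_distrib power_divide by (simp add: power2_eq_square)
        then show ?thesis by (simp add: power_divide)
      qed
      then have "(b x - 1/2)\<^sup>2 = a x - (a x)\<^sup>2" for x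
        by (simp add: a_def b_def)
      then show ?thesis using that by (auto simp: ea eb)
    qed
  qed simp
  define F where "F u = (if u a = 0 then None else Some ((u b - 1/2) / u a))"
    for u :: "('a \<Rightarrow> real) \<Rightarrow> real"
  have F: "continuous_map stone_cech (Alexandroff_compactification euclideanreal) F"
    unfolding F_def by (rule continuous_map_Alexandroff_circle [OF ca cb circle])
  have Fx: "F (stone_cech_embed x) = Some (f x)" for x
    using pos [of x] by (simp add: F_def ea eb) (simp add: a_def b_def)
  show "\<exists>F. F \<in> extensional (topspace stone_cech) \<and>
     continuous_map stone_cech (Alexandroff_compactification euclideanreal) F \<and>
     (\<forall>x. F (stone_cech_embed x) = Some (f x))"
    using continuous_map_eq [OF F, of "restrict F (topspace stone_cech)"] Fx stone_cech_embed_in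
    by (intro exI [of _ "restrict F (topspace stone_cech)"]) auto
next
  fix F G :: "(('a \<Rightarrow> real) \<Rightarrow> real) \<Rightarrow> real option"
  assume F: "F \<in> extensional (topspace stone_cech) \<and>
     continuous_map stone_cech (Alexandroff_compactification euclideanreal) F \<and>
     (\<forall>x. F (stone_cech_embed x) = Some (f x))"
    and G: "G \<in> extensional (topspace stone_cech) \<and>
     continuous_map stone_cech (Alexandroff_compactification euclideanreal) G \<and>
     (\<forall>x. G (stone_cech_embed x) = Some (f x))"
  show "F = G"
  proof (rule extensionalityI)
    fix u :: "('a \<Rightarrow> real) \<Rightarrow> real" assume u: "u \<in> topspace stone_cech"
    show "F u = G u"
    proof (rule forall_in_closure_of_eq [where f = F and g = G and S = "range stone_cech_embed"
            and X = stone_cech and Y = "Alexandroff_compactification euclideanreal"])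
      show "u \<in> stone_cech closure_of range stone_cech_embed"
        using u by (simp add: stone_cech_dense)
      show "F v = G v" if "v \<in> range stone_cech_embed" for v
        using F G that by auto
    qed (use F G Hausdorff_Alexandroff_real in blast)+
  qed (use F G in auto)
qed

lemma
  fixes f :: "'a::topological_space \<Rightarrow> real"
  assumes "f \<in> real_cont"
  shows continuous_map_beta_ext:
      "continuous_map stone_cech (Alexandroff_compactification euclideanreal) (beta_ext f)"
    and beta_ext_embed: "beta_ext f (stone_cech_embed x) = Some (f x)"
  using theI' [OF ex1_beta_ext [OF assms]] unfolding beta_ext_def by auto

text \<open>The preimages of the two balls are open neighbourhoods of \<open>u\<close>, and their
  intersection meets the dense set of embedded points.\<close>

lemma beta_ext_simultaneous_approx:
  fixes f g :: "'a::topological_space \<Rightarrow> real"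
  assumes u: "u \<in> topspace stone_cech"
    and f: "f \<in> real_cont" "beta_ext f u = Some r"
    and g: "g \<in> real_cont" "beta_ext g u = Some s"
    and "\<epsilon> > 0"
  obtains x where "\<bar>f x - r\<bar> < \<epsilon>" "\<bar>g x - s\<bar> < \<epsilon>"
proof -
  let ?N = "\<lambda>f r. {v \<in> topspace stone_cech. beta_ext f v \<in> Some ` ball r \<epsilon>}"
  have N: "openin stone_cech (?N h t)" if "h \<in> real_cont" for h :: "'a \<Rightarrow> real" and t
    by (rule openin_continuous_map_preimage [OF continuous_map_beta_ext [OF that]]) simp
  define W where "W = ?N f r \<inter> ?N g s"
  have "openin stone_cech W"
    unfolding W_def by (intro openin_Int N f g)
  moreover have "u \<in> W"
    using u f g \<open>\<epsilon> > 0\<close> by (auto simp: W_def)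
  moreover have "u \<in> stone_cech closure_of range stone_cech_embed"
    using u by (simp add: stone_cech_dense)
  ultimately obtain x where "stone_cech_embed x \<in> W"
    by (auto simp: in_closure_of)
  then show thesis
    using that [of x] f g by (auto simp: W_def beta_ext_embed dist_real_def abs_minus_commute)
qed

section \<open>Truncation homomorphisms\<close>

locale truncation_hom =
  fixes L :: "('a::topological_space \<Rightarrow> real) set" and \<psi> :: "('a \<Rightarrow> real) \<Rightarrow> real"
  assumes sublattice: "truncated_vector_sublattice L"
    and hom: "truncation_homomorphism L \<psi>"
begin

lemma
  shows L_cont: "f \<in> L \<Longrightarrow> f \<in> real_cont"
    and L_zero: "(\<lambda>x. 0) \<in> L"
    and L_add: "f \<in> L \<Longrightarrow> g \<in> L \<Longrightarrow> (\<lambda>x. f x + g x) \<in> L"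
    and L_scale: "f \<in> L \<Longrightarrow> (\<lambda>x. c * f x) \<in> L"
    and L_min: "f \<in> L \<Longrightarrow> g \<in> L \<Longrightarrow> (\<lambda>x. min (f x) (g x)) \<in> L"
    and L_min_1: "f \<in> L \<Longrightarrow> (\<lambda>x. min (f x) 1) \<in> L"
  using sublattice unfolding truncated_vector_sublattice_def by auto

lemma
  shows psi_add: "f \<in> L \<Longrightarrow> g \<in> L \<Longrightarrow> \<psi> (\<lambda>x. f x + g x) = \<psi> f + \<psi> g"
    and psi_scale: "f \<in> L \<Longrightarrow> \<psi> (\<lambda>x. c * f x) = c * \<psi> f"
    and psi_min_1: "f \<in> L \<Longrightarrow> \<psi> (\<lambda>x. min (f x) 1) = min (\<psi> f) 1"
  using hom unfolding truncation_homomorphism_def nonzero_linear_functional_def by auto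

lemma L_diff: "f \<in> L \<Longrightarrow> g \<in> L \<Longrightarrow> (\<lambda>x. f x - g x) \<in> L"
  using L_add [of f "\<lambda>x. -1 * g x"] L_scale [of g "-1"] by simp

lemma psi_diff: "f \<in> L \<Longrightarrow> g \<in> L \<Longrightarrow> \<psi> (\<lambda>x. f x - g x) = \<psi> f - \<psi> g"
  using psi_add [of f "\<lambda>x. -1 * g x"] L_scale [of g "-1"] psi_scale [of g "-1"] by simp

lemma psi_zero: "\<psi> (\<lambda>x. 0) = 0"
  using psi_scale [OF L_zero, of 0] by simp

section \<open>Order bounds and absolute values\<close>

text \<open>After division by \<open>c\<close> the function is fixed by truncation at 1. This bound
  does the work of positivity even when \<open>L\<close> lacks the constants.\<close>

lemma psi_le_const:
  assumes f: "f \<in> L" and c: "c > 0" and le: "\<And>x. f x \<le> c"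
  shows "\<psi> f \<le> c"
proof -
  have "(\<lambda>x. min (inverse c * f x) 1) = (\<lambda>x. inverse c * f x)"
    using le c by (auto simp: min_def field_simps)
  then have "inverse c * \<psi> f \<le> 1"
    using psi_min_1 [OF L_scale [OF f, of "inverse c"]] psi_scale [OF f, of "inverse c"]
    by (simp add: min_def split: if_splits)
  then show ?thesis using c by (simp add: field_simps)
qed

text \<open>Truncation at \<open>c\<close> is truncation at 1 conjugated by multiplication by
  \<open>c\<close>.\<close>

lemma
  assumes f: "f \<in> L" and c: "c > 0"
  shows L_min_const: "(\<lambda>x. min (f x) c) \<in> L"
    and psi_min_const: "\<psi> (\<lambda>x. min (f x) c) = min (\<psi> f) c"
proof -
  have eq: "(\<lambda>x. min (f x) c) = (\<lambda>x. c * min (inverse c * f x) 1)"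
    using c by (auto simp: min_def field_simps)
  show "(\<lambda>x. min (f x) c) \<in> L"
    unfolding eq by (intro L_scale L_min_1 f)
  show "\<psi> (\<lambda>x. min (f x) c) = min (\<psi> f) c"
    unfolding eq psi_scale [OF L_min_1 [OF L_scale [OF f]]] psi_min_1 [OF L_scale [OF f]]
      psi_scale [OF f]
    using c by (simp add: min_def field_simps)
qed

text \<open>The truncations at \<open>c > 0\<close> and at 0 differ by at most \<open>c\<close>
  pointwise, so \<open>psi_le_const\<close> bounds the difference of their \<psi>-values; then
  \<open>c\<close> tends to 0.\<close>

lemma psi_min_0:
  assumes f: "f \<in> L"
  shows "\<psi> (\<lambda>x. min (f x) 0) = min (\<psi> f) 0"
proof -
  have f0: "(\<lambda>x. min (f x) 0) \<in> L" using L_min [OF f L_zero] by simp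
  have close: "\<bar>min (\<psi> f) c - \<psi> (\<lambda>x. min (f x) 0)\<bar> \<le> c" if c: "c > 0" for c
  proof -
    note fc = L_min_const [OF f c]
    have "\<psi> (\<lambda>x. min (f x) c - min (f x) 0) \<le> c" "\<psi> (\<lambda>x. min (f x) 0 - min (f x) c) \<le> c"
      using c by (intro psi_le_const L_diff f0 fc; auto simp: min_def)+
    then show ?thesis by (simp add: psi_diff f0 fc psi_min_const f c abs_le_iff)
  qed
  \<comment> \<open>One half of \<epsilon> covers the bound \<open>close\<close>, the other the
    passage from \<open>min (\<psi> f) c\<close> to \<open>min (\<psi> f) 0\<close>.\<close>
  have "\<bar>min (\<psi> f) 0 - \<psi> (\<lambda>x. min (f x) 0)\<bar> \<le> 0 + \<epsilon>" if "\<epsilon> > 0" for \<epsilon>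
    using close [of "\<epsilon> / 2"] that by (auto simp: min_def abs_if split: if_splits)
  then have "\<bar>min (\<psi> f) 0 - \<psi> (\<lambda>x. min (f x) 0)\<bar> \<le> 0" by (rule field_le_epsilon)
  then show ?thesis by simp
qed

lemma
  assumes f: "f \<in> L"
  shows L_abs: "(\<lambda>x. \<bar>f x\<bar>) \<in> L" and psi_abs: "\<psi> (\<lambda>x. \<bar>f x\<bar>) = \<bar>\<psi> f\<bar>"
proof -
  have f0: "(\<lambda>x. min (f x) 0) \<in> L" using L_min [OF f L_zero] by simp
  have eq: "(\<lambda>x. \<bar>f x\<bar>) = (\<lambda>x. f x - 2 * min (f x) 0)" by (auto simp: min_def)
  show "(\<lambda>x. \<bar>f x\<bar>) \<in> L"
    unfolding eq by (intro L_diff L_scale f f0)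
  show "\<psi> (\<lambda>x. \<bar>f x\<bar>) = \<bar>\<psi> f\<bar>"
    unfolding eq psi_diff [OF f L_scale [OF f0]] psi_scale [OF f0] psi_min_0 [OF f] by simp
qed

lemma
  assumes "finite S" and "\<And>i. i \<in> S \<Longrightarrow> h i \<in> L"
  shows L_sum: "(\<lambda>x. \<Sum>i\<in>S. h i x) \<in> L"
    and psi_sum: "\<psi> (\<lambda>x. \<Sum>i\<in>S. h i x) = (\<Sum>i\<in>S. \<psi> (h i))"
proof -
  have "(\<lambda>x. \<Sum>i\<in>S. h i x) \<in> L \<and> \<psi> (\<lambda>x. \<Sum>i\<in>S. h i x) = (\<Sum>i\<in>S. \<psi> (h i))"
    using assms by (induction S rule: finite_induct) (auto simp: L_zero psi_zero L_add psi_add)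
  then show "(\<lambda>x. \<Sum>i\<in>S. h i x) \<in> L" "\<psi> (\<lambda>x. \<Sum>i\<in>S. h i x) = (\<Sum>i\<in>S. \<psi> (h i))" by auto
qed

section \<open>Approximation by points and compactness\<close>

text \<open>Rescaling gives the value 1; truncation keeps this value and bounds the function by 1.
  The result stands in for the constant 1, which \<open>L\<close> may lack.\<close>

lemma ex_approximate_unit:
  obtains e where "e \<in> L" "\<psi> e = 1" "\<And>x. e x \<le> 1"
proof -
  obtain f where f: "f \<in> L" "\<psi> f \<noteq> 0"
    using hom unfolding truncation_homomorphism_def nonzero_linear_functional_def by auto
  define g where "g = (\<lambda>x. inverse (\<psi> f) * f x)"
  have g: "g \<in> L" "\<psi> g = 1"
    unfolding g_def using f by (auto simp: L_scale psi_scale)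
  show thesis
    by (rule that [of "\<lambda>x. min (g x) 1"]) (auto simp: g psi_min_1 L_min_1)
qed

text \<open>\<open>S\<close> pairs functions with tolerances; this supplies the finite intersection
  property for the compactness argument.\<close>

lemma ex_approximate_point:
  assumes S: "finite S" "S \<subseteq> L \<times> {0<..}"
  obtains x where "\<And>f \<epsilon>. (f, \<epsilon>) \<in> S \<Longrightarrow> \<bar>f x - \<psi> f\<bar> \<le> \<epsilon>"
proof -
  obtain e where e: "e \<in> L" "\<psi> e = 1" "\<And>x. e x \<le> 1"
    using ex_approximate_unit by blast
  \<comment> \<open>The final error for \<open>f\<close> is at most
    \<open>d * (1 + \<bar>\<psi> f\<bar>)\<close>, so a small \<open>d\<close> meets all the
    tolerances; \<open>d < 1\<close> will make \<open>1 - d\<close> positive, as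
    \<open>psi_le_const\<close> requires.\<close>
  have "\<forall>\<^sub>F d in at_right 0. d * (1 + \<bar>\<psi> (fst p)\<bar>) \<le> snd p" if "p \<in> S" for p
  proof -
    have "((\<lambda>d. d * (1 + \<bar>\<psi> (fst p)\<bar>)) \<longlongrightarrow> 0 * (1 + \<bar>\<psi> (fst p)\<bar>)) (at_right 0)"
      by (intro tendsto_intros)
    moreover have "0 < snd p" using S that by auto
    ultimately have "\<forall>\<^sub>F d in at_right 0. d * (1 + \<bar>\<psi> (fst p)\<bar>) < snd p"
      by (intro order_tendstoD(2)) auto
    then show ?thesis by (rule eventually_mono) simp
  qed
  then have "\<forall>\<^sub>F d in at_right 0. \<forall>p\<in>S. d * (1 + \<bar>\<psi> (fst p)\<bar>) \<le> snd p"
    using S(1) by (simp add: eventually_ball_finite)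
  moreover have "\<forall>\<^sub>F d in at_right (0::real). d \<in> {0<..<1}"
    by (rule eventually_at_right_real) simp
  ultimately have "\<forall>\<^sub>F d in at_right 0. (\<forall>p\<in>S. d * (1 + \<bar>\<psi> (fst p)\<bar>) \<le> snd p) \<and> d \<in> {0<..<1}"
    by (rule eventually_conj)
  then obtain d where "(\<forall>p\<in>S. d * (1 + \<bar>\<psi> (fst p)\<bar>) \<le> snd p) \<and> d \<in> {0<..<1}"
    using eventually_happens' [OF trivial_limit_at_right_real] by blast
  then have d: "\<And>p. p \<in> S \<Longrightarrow> d * (1 + \<bar>\<psi> (fst p)\<bar>) \<le> snd p" "0 < d" "d < 1"
    by auto
  define g where "g p x = \<bar>fst p x - \<psi> (fst p) * e x\<bar>" for p :: "('a \<Rightarrow> real) \<times> real" and x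
  have g: "g p \<in> L" "\<psi> (g p) = 0" if "p \<in> S" for p
  proof -
    have "fst p \<in> L" using S that by auto
    then show "g p \<in> L" "\<psi> (g p) = 0"
      unfolding g_def using e by (simp_all add: L_abs psi_abs L_diff psi_diff L_scale psi_scale)
  qed
  define h where "h x = e x - (\<Sum>p\<in>S. g p x)" for x
  have h: "h \<in> L" "\<psi> h = 1"
    unfolding h_def using S g e by (simp_all add: L_diff L_sum psi_diff psi_sum)
  \<comment> \<open>If \<open>h\<close> were at most \<open>1 - d\<close> everywhere,
    \<open>psi_le_const\<close> would give \<open>\<psi> h \<le> 1 - d\<close>.\<close>
  obtain x where x: "h x > 1 - d"
  proof -
    have "\<not> \<psi> h \<le> 1 - d" using h(2) d(2) by simp
    then have "\<not> (\<forall>x. h x \<le> 1 - d)"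
      using psi_le_const [OF h(1), of "1 - d"] d(3) by auto
    then show thesis using that by (auto simp: not_le)
  qed
  have sum0: "0 \<le> (\<Sum>p\<in>S. g p x)" by (simp add: g_def sum_nonneg)
  show thesis
  proof (rule that)
    fix f \<epsilon> assume p: "(f, \<epsilon>) \<in> S"
    \<comment> \<open>Since \<open>e x \<le> 1\<close> and all \<open>g p x\<close> are nonnegative,
      \<open>h x > 1 - d\<close> forces both the sum and \<open>1 - e x\<close> below
      \<open>d\<close>.\<close>
    have "g (f, \<epsilon>) x \<le> (\<Sum>p\<in>S. g p x)"
      using S p by (intro member_le_sum) (auto simp: g_def)
    then have gd: "\<bar>f x - \<psi> f * e x\<bar> \<le> d"
      using x e(3) [of x] unfolding h_def by (simp add: g_def)
    have "\<bar>e x - 1\<bar> \<le> d"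
      using x sum0 e(3) [of x] unfolding h_def by simp
    then have "\<bar>\<psi> f * (e x - 1)\<bar> \<le> \<bar>\<psi> f\<bar> * d"
      unfolding abs_mult by (intro mult_left_mono) auto
    then have "\<bar>f x - \<psi> f\<bar> \<le> d + \<bar>\<psi> f\<bar> * d"
      using gd abs_triangle_ineq [of "f x - \<psi> f * e x" "\<psi> f * (e x - 1)"]
      by (simp add: algebra_simps)
    also have "\<dots> \<le> \<epsilon>" using d(1) [OF p] by (simp add: algebra_simps)
    finally show "\<bar>f x - \<psi> f\<bar> \<le> \<epsilon>" .
  qed
qed

text \<open>The sets \<open>D p\<close> are closed, because a compact interval stays closed in the
  one-point compactification, and any finitely many of them share an embedded point. By compactness
  they all have a common point, and the tolerances then shrink to 0.\<close>

lemma ex_point_stone_cech: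
  "\<exists>u\<in>topspace stone_cech. \<forall>f\<in>L. beta_ext f u = Some (\<psi> f)"
proof -
  define D where "D p = {u \<in> topspace stone_cech.
    beta_ext (fst p) u \<in> Some ` cball (\<psi> (fst p)) (snd p)}" for p
  have "closedin stone_cech (D p)" if "p \<in> L \<times> {0<..}" for p
    unfolding D_def using that
    by (intro closedin_continuous_map_preimage
          [where Y = "Alexandroff_compactification euclideanreal"] continuous_map_beta_ext)
       (auto simp: L_cont)
  moreover have "\<Inter> (D ` S) \<noteq> {}" if S: "finite S" "S \<subseteq> L \<times> {0<..}" for S
  proof -
    obtain x where x: "\<And>f \<epsilon>. (f, \<epsilon>) \<in> S \<Longrightarrow> \<bar>f x - \<psi> f\<bar> \<le> \<epsilon>"
      using ex_approximate_point [OF S] by blast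
    have "stone_cech_embed x \<in> D p" if "p \<in> S" for p
      using S x [of "fst p" "snd p"] that
      by (auto simp: D_def stone_cech_embed_in beta_ext_embed L_cont dist_real_def abs_minus_commute)
    then show ?thesis by blast
  qed
  ultimately have "\<Inter> (D ` (L \<times> {0<..})) \<noteq> {}"
    using compact_space_stone_cech [unfolded compact_space_fip, rule_format, of "D ` (L \<times> {0<..})"]
    by (simp only: all_finite_subset_image ball_simps) blast
  then obtain u where u: "\<And>f \<epsilon>. f \<in> L \<Longrightarrow> \<epsilon> > 0 \<Longrightarrow> u \<in> D (f, \<epsilon>)"
    by auto
  have "beta_ext f u = Some (\<psi> f)" if f: "f \<in> L" for f
  proof -
    \<comment> \<open>Radius 1 already excludes the point at infinity.\<close>
    obtain r where r: "beta_ext f u = Some r"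
      using u [OF f, of 1] by (auto simp: D_def)
    have "\<bar>\<psi> f - r\<bar> \<le> 0 + \<epsilon>" if "\<epsilon> > 0" for \<epsilon>
      using u [OF f that] r by (auto simp: D_def dist_real_def)
    then have "\<bar>\<psi> f - r\<bar> \<le> 0" by (rule field_le_epsilon)
    then show ?thesis using r by simp
  qed
  moreover have "u \<in> topspace stone_cech"
    using u [OF L_zero, of 1] by (auto simp: D_def)
  ultimately show ?thesis by blast
qed

end

section \<open>From points of the compactification back to homomorphisms\<close>

text \<open>Both functions are approximated at a common point \<open>x\<close>, where truncation is
  exact; as \<open>min t 1\<close> is 1-Lipschitz in \<open>t\<close>, the two errors simply
  add.\<close>

lemma truncation_of_beta_ext:
  fixes f :: "'a::topological_space \<Rightarrow> real"
  assumes u: "u \<in> topspace stone_cech"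
    and f: "f \<in> real_cont" "beta_ext f u = Some r"
    and g: "(\<lambda>x. min (f x) 1) \<in> real_cont" "beta_ext (\<lambda>x. min (f x) 1) u = Some s"
  shows "s = min r 1"
proof -
  have "\<bar>s - min r 1\<bar> \<le> 0 + \<epsilon>" if "\<epsilon> > 0" for \<epsilon>
  proof -
    obtain x where "\<bar>f x - r\<bar> < \<epsilon> / 2" "\<bar>min (f x) 1 - s\<bar> < \<epsilon> / 2"
      using beta_ext_simultaneous_approx [OF u f g, of "\<epsilon> / 2"] \<open>\<epsilon> > 0\<close> by auto
    then show ?thesis by (auto simp: min_def abs_if split: if_splits)
  qed
  then have "\<bar>s - min r 1\<bar> \<le> 0" by (rule field_le_epsilon)
  then show ?thesis by simp
qed

theorem theorem4p1:
  fixes L :: "('a::topological_space \<Rightarrow> real) set"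
    and \<psi> :: "('a \<Rightarrow> real) \<Rightarrow> real"
  assumes "tychonoff_space (euclidean :: 'a topology)"
    and "truncated_vector_sublattice L"
    and "nonzero_linear_functional L \<psi>"
  shows "truncation_homomorphism L \<psi> \<longleftrightarrow>
    (\<exists>u\<in>topspace stone_cech. \<forall>f\<in>L. beta_ext f u = Some (\<psi> f))"
proof
  assume "truncation_homomorphism L \<psi>"
  then interpret truncation_hom L \<psi>
    using assms by unfold_locales
  show "\<exists>u\<in>topspace stone_cech. \<forall>f\<in>L. beta_ext f u = Some (\<psi> f)"
    by (rule ex_point_stone_cech)
next
  assume "\<exists>u\<in>topspace stone_cech. \<forall>f\<in>L. beta_ext f u = Some (\<psi> f)"
  then obtain u where u: "u \<in> topspace stone_cech" "\<And>f. f \<in> L \<Longrightarrow> beta_ext f u = Some (\<psi> f)"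
    by blast
  have "\<psi> (\<lambda>x. min (f x) 1) = min (\<psi> f) 1" if f: "f \<in> L" for f
  proof -
    have "(\<lambda>x. min (f x) 1) \<in> L" "L \<subseteq> real_cont"
      using assms(2) f unfolding truncated_vector_sublattice_def by auto
    then show ?thesis
      using f u by (intro truncation_of_beta_ext [of u f]) auto
  qed
  then show "truncation_homomorphism L \<psi>"
    using assms(3) by (simp add: truncation_homomorphism_def)
qed

end
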